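(* Let $p>2$ be a prime, $n\ge1$, and $f\colon\mathbb{F}_p^n\to\mathbb{C}$ a $1$-bounded function. Define $b\colon\mathbb{F}_p^n\times\mathbb{F}_p^n\to\mathbb{C}$ by \[ b(h,h')=\mathbb{E}_{x\in\mathbb{F}_p^n}f(x)\overline{f(x+h)}\,\overline{f(x+h')}f(x+h+h'), \] so that $\|f\|_{U^3}^8=\mathbb{E}_{h,h'}|b(h,h')|^2$, and suppose $\|f\|_{U^3}^8\ge\delta$. Then for any integer $a$, \[ \mathbb{E}_{h,h'\in\mathbb{F}_p^n} b(ah,h')\overline{b(h,ah')}\ge \delta^{2^M}, \] where $M=6+\lfloor\log_2\lfloor\log_2|a|-1\rfloor\rfloor$ if $|a|\ge4$ and $M=5$ if $|a|<4$.
   Context: A function is $1$-bounded if its absolute value is at most $1$ everywhere. $\|f\|_{U^3}$ is the Gowers $U^3$ norm on $\mathbb{F}_p^n$.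
   Formalization: The formal theorem assumes δ ≥ 0, which the statement leaves implicit; for negative δ the claim fails (f = 0, δ = −1/2 gives average 0 but δ^{2^M} > 0). *)

theory Defs
  imports
    "HOL-Analysis.Finite_Cartesian_Product"
    "HOL-Analysis.Cartesian_Space"
    "Berlekamp_Zassenhaus.Finite_Field"
begin

definition avg :: "('a::finite \<Rightarrow> 'b::field_char_0) \<Rightarrow> 'b" where
  "avg g = (\<Sum>x\<in>UNIV. g x) / of_nat CARD('a)"

definition one_bounded :: "('a \<Rightarrow> complex) \<Rightarrow> bool" where
  "one_bounded f \<longleftrightarrow> (\<forall>x. norm (f x) \<le> 1)"

definition mult_deriv :: "'a::ab_group_add \<Rightarrow> ('a \<Rightarrow> complex) \<Rightarrow> 'a \<Rightarrow> complex" where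
  "mult_deriv h f x = f x * cnj (f (x + h))"

text \<open>The average under the root is real and nonnegative (see
  \<open>gowers_U3_average\<close> below), so taking the real part loses nothing.\<close>

definition gowers_U3_norm :: "('a::{ab_group_add,finite} \<Rightarrow> complex) \<Rightarrow> real" where
  "gowers_U3_norm f =
     root 8 (Re (avg (\<lambda>(x, h1, h2, h3).
       mult_deriv h1 (mult_deriv h2 (mult_deriv h3 f)) x)))"

definition b_fun :: "('a::{ab_group_add,finite} \<Rightarrow> complex) \<Rightarrow> 'a \<Rightarrow> 'a \<Rightarrow> complex" where
  "b_fun f h h' = avg (\<lambda>x. f x * cnj (f (x + h)) * cnj (f (x + h')) * f (x + h + h'))"

text \<open>For \<open>\<bar>a\<bar> \<ge> 4\<close> the integer converted by \<open>nat\<close> is at least \<open>6\<close>.\<close>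

definition exponent_M :: "int \<Rightarrow> nat" where
  "exponent_M a =
     (if \<bar>a\<bar> \<ge> 4
      then nat (6 + \<lfloor>log 2 (real_of_int \<lfloor>log 2 (real_of_int \<bar>a\<bar>) - 1\<rfloor>)\<rfloor>)
      else 5)"

lemma exponent_M_eq:
  assumes "\<bar>a\<bar> \<ge> 4"
  shows "int (exponent_M a) =
           6 + \<lfloor>log 2 (real_of_int \<lfloor>log 2 (real_of_int \<bar>a\<bar>) - 1\<rfloor>)\<rfloor>"
proof -
  have "log 2 (real_of_int \<bar>a\<bar>) \<ge> log 2 (2 ^ 2)"
    using assms by (subst log_le_cancel_iff) auto
  moreover have "log 2 (2 ^ 2 :: real) = 2"
    by (subst log_nat_power) auto
  ultimately have "log 2 (real_of_int \<bar>a\<bar>) - 1 \<ge> 1"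
    by linarith
  then have "\<lfloor>log 2 (real_of_int \<bar>a\<bar>) - 1\<rfloor> \<ge> 1"
    by linarith
  then have "log 2 (real_of_int \<lfloor>log 2 (real_of_int \<bar>a\<bar>) - 1\<rfloor>) \<ge> 0"
    by (subst zero_le_log_cancel_iff) linarith+
  then have "\<lfloor>log 2 (real_of_int \<lfloor>log 2 (real_of_int \<bar>a\<bar>) - 1\<rfloor>)\<rfloor> \<ge> 0"
    by linarith
  then show ?thesis
    using assms by (simp add: exponent_M_def)
qed

lemma avg_pair: "avg (\<lambda>(x, y). g x y) = avg (\<lambda>x. avg (\<lambda>y. g x y))"
  by (simp add: avg_def UNIV_Times_UNIV [symmetric] sum.cartesian_product [symmetric]
      card_cartesian_product sum_divide_distrib mult.commute del: UNIV_Times_UNIV)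

lemma avg_swap: "avg (\<lambda>x. avg (\<lambda>y. g x y)) = avg (\<lambda>y. avg (\<lambda>x. g x y))"
  unfolding avg_def sum_divide_distrib [symmetric]
  by (subst sum.swap) (simp add: mult.commute)

lemma avg_shift: "avg (\<lambda>k. g (x + k)) = avg g" for x :: "'a::{ab_group_add,finite}"
proof -
  have "bij_betw ((+) x) UNIV UNIV"
    by (rule bij_betw_byWitness [where f' = "\<lambda>y. y - x"]) auto
  then show ?thesis
    unfolding avg_def by (simp add: sum.reindex_bij_betw)
qed

lemma avg_mult_left: "avg (\<lambda>x. c * g x) = c * avg g"
  by (simp add: avg_def sum_distrib_left)

lemma avg_mult_right: "avg (\<lambda>x. g x * c) = avg g * c"
  by (simp add: avg_def sum_distrib_right)

lemma cnj_avg: "cnj (avg g) = avg (\<lambda>x. cnj (g x))"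
  by (simp add: avg_def)

lemma of_real_avg: "complex_of_real (avg g) = avg (\<lambda>x. complex_of_real (g x))"
  by (simp add: avg_def)

lemma gowers_U3_average:
  "avg (\<lambda>(x, h1, h2, h3). mult_deriv h1 (mult_deriv h2 (mult_deriv h3 f)) x) =
     complex_of_real (avg (\<lambda>(h, h'). (norm (b_fun f h h'))\<^sup>2))"
proof -
  define F where "F h h' x = f x * cnj (f (x + h)) * cnj (f (x + h')) * f (x + h + h')" for h h' x
  have md: "mult_deriv h1 (mult_deriv h2 (mult_deriv h3 f)) x = F h2 h3 x * cnj (F h2 h3 (x + h1))"
    for h1 h2 h3 x
    by (simp add: mult_deriv_def F_def algebra_simps)
  have sq: "complex_of_real ((norm (b_fun f h h'))\<^sup>2) =
      avg (\<lambda>x. avg (\<lambda>k. F h h' x * cnj (F h h' (x + k))))" for h h'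
  proof -
    have "complex_of_real ((norm (b_fun f h h'))\<^sup>2) = avg (F h h') * cnj (avg (F h h'))"
      unfolding complex_norm_square b_fun_def F_def by (rule refl)
    also have "\<dots> = avg (\<lambda>x. F h h' x * avg (\<lambda>k. cnj (F h h' k)))"
      by (simp add: cnj_avg avg_mult_right)
    also have "\<dots> = avg (\<lambda>x. F h h' x * avg (\<lambda>k. cnj (F h h' (x + k))))"
      by (simp add: avg_shift [of "\<lambda>k. cnj (F h h' k)"])
    finally show ?thesis by (simp add: avg_mult_left)
  qed
  have "avg (\<lambda>(x, h1, h2, h3). mult_deriv h1 (mult_deriv h2 (mult_deriv h3 f)) x) =
      avg (\<lambda>x. avg (\<lambda>k. avg (\<lambda>h. avg (\<lambda>h'. F h h' x * cnj (F h h' (x + k))))))"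
    by (simp add: md avg_pair)
  also have "\<dots> = avg (\<lambda>x. avg (\<lambda>h. avg (\<lambda>k. avg (\<lambda>h'. F h h' x * cnj (F h h' (x + k))))))"
    by (subst avg_swap) (rule refl)
  also have "\<dots> = avg (\<lambda>h. avg (\<lambda>x. avg (\<lambda>k. avg (\<lambda>h'. F h h' x * cnj (F h h' (x + k))))))"
    by (rule avg_swap)
  also have "\<dots> = avg (\<lambda>h. avg (\<lambda>x. avg (\<lambda>h'. avg (\<lambda>k. F h h' x * cnj (F h h' (x + k))))))"
    by (subst (3) avg_swap) (rule refl)
  also have "\<dots> = avg (\<lambda>h. avg (\<lambda>h'. avg (\<lambda>x. avg (\<lambda>k. F h h' x * cnj (F h h' (x + k))))))"
    by (subst (2) avg_swap) (rule refl)
  finally show ?thesis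
    by (simp add: sq [symmetric] avg_pair of_real_avg del: of_real_power)
qed

lemma gowers_U3_norm_power8:
  "gowers_U3_norm f ^ 8 = avg (\<lambda>(h, h'). (norm (b_fun f h h'))\<^sup>2)"
proof -
  have "avg (\<lambda>(h, h'). (norm (b_fun f h h'))\<^sup>2) \<ge> 0"
    by (auto simp: avg_def intro!: divide_nonneg_nonneg sum_nonneg)
  then show ?thesis
    by (simp add: gowers_U3_norm_def gowers_U3_average)
qed

end

(*
  Let mu(h, r) be the squared modulus of the Fourier coefficient at r of x |-> f(x) cnj(f(x + h)).
  Since b(h, h') is the Fourier transform of mu(h, .) and b is symmetric, mu is its own symplectic
  Fourier transform on V = G x G. Hence mu is nonnegative and positive definite, has mass at most |G|,
  and with sums over V normalised by |G| the quantities of the theorem become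
  ||f||^8 = sum mu(v)^2 and S_a = sum mu(v) mu(a v).

  Positive definiteness bounds S_a from below by any such sum over more variables from which the pair
  (v, a v) is obtained by setting the arguments of some factors to 0: shifting the arguments of the
  remaining factors can only decrease their sum. Cauchy-Schwarz (five times) shows that a symmetric
  kernel K_v(y, y') whose factors allow y + v to be replaced by 2(y + v) or 2(y + v) + v has
  sum_v mu(v) <phi_v, K_v phi_v> >= delta^32, and further applications give delta^(32 m) for the
  power K_v^m when m is a power of 2. If |a| has at most m + 1 binary digits, the chain of length m
  starting at v can be made to end at a v, so S_a >= delta^(32 m).
*)
theory Submission
  imports Defs "HOL-Analysis.Convex"
begin

section \<open>Normalised sums against an abstract positive definite weight\<close>

primrec nat_mult :: "nat \<Rightarrow> 'a::ab_group_add \<Rightarrow> 'a" where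
  "nat_mult 0 v = 0"
| "nat_mult (Suc n) v = v + nat_mult n v"

lemma nat_mult_add: "nat_mult (m + n) v = nat_mult m v + nat_mult n v"
  by (induction m) (auto simp: add.assoc)

text \<open>In the application N is the square root of the size of the group carrying \<mu>, the
  normalisation under which \<mu> is its own Fourier transform. The axiom \<open>pos_def\<close> is
  Cauchy-Schwarz for the form with kernel \<open>\<mu> (c - d)\<close>, between g and the point mass
  at 0, whose own square is \<open>\<mu> 0\<close>, at most 1.\<close>

locale self_dual_weight =
  fixes \<mu> :: "'v::{ab_group_add,finite} \<Rightarrow> real" and N :: real
  assumes N_pos: "N > 0"
    and nonneg: "\<mu> v \<ge> 0"
    and le_one: "\<mu> v \<le> 1"
    and even: "\<mu> (- v) = \<mu> v"
    and mass: "(\<Sum>v\<in>UNIV. \<mu> v) \<le> N"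
    and pos_def: "(\<Sum>v\<in>UNIV. g v * \<mu> v)\<^sup>2 \<le> (\<Sum>c\<in>UNIV. \<Sum>d\<in>UNIV. g c * g d * \<mu> (c - d))"
begin

definition nsum :: "('v \<Rightarrow> real) \<Rightarrow> real" where
  "nsum F = (\<Sum>v\<in>UNIV. F v) / N"

definition wsum :: "('v \<Rightarrow> real) \<Rightarrow> real" where
  "wsum F = nsum (\<lambda>v. \<mu> v * F v)"

lemma nsum_mono: "(\<And>v. F v \<le> G v) \<Longrightarrow> nsum F \<le> nsum G"
  using N_pos by (auto simp: nsum_def intro!: divide_right_mono sum_mono)

lemma nsum_nonneg: "(\<And>v. F v \<ge> 0) \<Longrightarrow> nsum F \<ge> 0"
  using N_pos by (auto simp: nsum_def intro!: divide_nonneg_pos sum_nonneg)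

lemma nsum_swap: "nsum (\<lambda>x. nsum (\<lambda>y. F x y)) = nsum (\<lambda>y. nsum (\<lambda>x. F x y))"
  unfolding nsum_def sum_divide_distrib [symmetric] by (subst sum.swap) simp

lemma nsum_mult_left: "c * nsum F = nsum (\<lambda>v. c * F v)"
  by (simp add: nsum_def sum_distrib_left)

lemma nsum_mult_right: "nsum F * c = nsum (\<lambda>v. F v * c)"
  by (simp add: nsum_def sum_distrib_right)

lemma nsum_translate: "nsum (\<lambda>v. F (v + c)) = nsum F"
  unfolding nsum_def
  by (subst sum.reindex_bij_witness [of UNIV "\<lambda>v. v - c" "\<lambda>v. v + c" UNIV F]) auto

lemma nsum_reflect: "nsum (\<lambda>v. F (c - v)) = nsum F"
  unfolding nsum_def
  by (subst sum.reindex_bij_witness [of UNIV "\<lambda>v. c - v" "\<lambda>v. c - v" UNIV F]) auto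

lemma nsum_Cauchy_Schwarz:
  assumes "\<And>v. w v \<ge> 0"
  shows "(nsum (\<lambda>v. w v * F v))\<^sup>2 \<le> nsum w * nsum (\<lambda>v. w v * (F v)\<^sup>2)"
proof -
  have "(\<Sum>v\<in>UNIV. sqrt (w v) * (sqrt (w v) * F v))\<^sup>2
      \<le> (\<Sum>v\<in>UNIV. (sqrt (w v))\<^sup>2) * (\<Sum>v\<in>UNIV. (sqrt (w v) * F v)\<^sup>2)"
    by (rule Cauchy_Schwarz_ineq_sum)
  then have "(\<Sum>v\<in>UNIV. w v * F v)\<^sup>2 \<le> (\<Sum>v\<in>UNIV. w v) * (\<Sum>v\<in>UNIV. w v * (F v)\<^sup>2)"
    by (simp add: power_mult_distrib assms mult.assoc [symmetric] real_sqrt_mult_self)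
  then show ?thesis
    using N_pos by (simp add: nsum_def power_divide divide_right_mono flip: power2_eq_square)
qed

lemma nsum_weight: "nsum \<mu> \<le> 1"
  using mass N_pos by (simp add: nsum_def)

lemma nsum_weight_translate: "nsum (\<lambda>v. \<mu> (v + c)) \<le> 1"
  using nsum_weight by (simp add: nsum_translate)

lemma wsum_mono: "(\<And>v. F v \<le> G v) \<Longrightarrow> wsum F \<le> wsum G"
  by (auto simp: wsum_def nonneg intro!: nsum_mono mult_left_mono)

lemma wsum_nonneg: "(\<And>v. F v \<ge> 0) \<Longrightarrow> wsum F \<ge> 0"
  by (auto simp: wsum_def nonneg intro!: nsum_nonneg mult_nonneg_nonneg)

lemma wsum_swap: "wsum (\<lambda>x. wsum (\<lambda>y. F x y)) = wsum (\<lambda>y. wsum (\<lambda>x. F x y))"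
proof -
  have "wsum (\<lambda>x. wsum (\<lambda>y. F x y)) = nsum (\<lambda>x. nsum (\<lambda>y. \<mu> x * (\<mu> y * F x y)))"
    by (simp add: wsum_def nsum_mult_left)
  also have "\<dots> = nsum (\<lambda>y. nsum (\<lambda>x. \<mu> y * (\<mu> x * F x y)))"
    by (subst nsum_swap) (simp add: mult.left_commute)
  finally show ?thesis
    by (simp add: wsum_def nsum_mult_left)
qed

lemma wsum_nsum_swap: "wsum (\<lambda>x. nsum (\<lambda>y. F x y)) = nsum (\<lambda>y. wsum (\<lambda>x. F x y))"
  unfolding wsum_def nsum_mult_left by (rule nsum_swap)

lemma wsum_le:
  assumes "S \<ge> 0" and "\<And>v. F v \<le> S"
  shows "wsum F \<le> S"
proof -
  have "wsum F \<le> wsum (\<lambda>_. S)"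
    by (rule wsum_mono) (rule assms)
  also have "\<dots> = nsum \<mu> * S"
    by (simp add: wsum_def nsum_mult_right)
  also have "\<dots> \<le> 1 * S"
    by (rule mult_right_mono [OF nsum_weight assms(1)])
  finally show ?thesis by simp
qed

text \<open>Cauchy-Schwarz against the constant 1; no constant is lost because the weight has
  normalised mass at most 1.\<close>

lemma wsum_square_le: "(wsum F)\<^sup>2 \<le> wsum (\<lambda>v. (F v)\<^sup>2)"
proof -
  have "(wsum F)\<^sup>2 \<le> nsum \<mu> * wsum (\<lambda>v. (F v)\<^sup>2)"
    unfolding wsum_def by (rule nsum_Cauchy_Schwarz) (rule nonneg)
  also have "\<dots> \<le> 1 * wsum (\<lambda>v. (F v)\<^sup>2)"
    by (rule mult_right_mono [OF nsum_weight wsum_nonneg]) simp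
  finally show ?thesis by simp
qed

lemma pos_def_nsum:
  "(nsum (\<lambda>v. g v * \<mu> v))\<^sup>2 \<le> nsum (\<lambda>c. nsum (\<lambda>d. g c * g d * \<mu> (c - d)))"
  using pos_def [of g] N_pos
  by (simp add: nsum_def power_divide sum_divide_distrib [symmetric] divide_right_mono power2_eq_square)

section \<open>Energy and weighted parallelograms\<close>

text \<open>For the weight of f this is the eighth power of the U^3 norm, see
  \<open>U3_norm_eq_weight\<close>.\<close>

definition energy :: real where "energy = nsum (\<lambda>v. (\<mu> v)\<^sup>2)"

definition square_count :: "'v \<Rightarrow> 'v \<Rightarrow> real" where
  "square_count \<alpha> \<beta> = nsum (\<lambda>x. \<mu> x * \<mu> (x + \<alpha>) * \<mu> (x + \<beta>) * \<mu> (x + \<alpha> + \<beta>))"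

lemma square_count_nonneg: "square_count \<alpha> \<beta> \<ge> 0"
  by (auto simp: square_count_def nonneg intro!: nsum_nonneg)

lemma energy_nonneg: "energy \<ge> 0"
  by (auto simp: energy_def intro!: nsum_nonneg)

lemma energy_le_one: "energy \<le> 1"
proof -
  have "energy \<le> nsum \<mu>"
    unfolding energy_def
    by (rule nsum_mono) (use nonneg le_one in \<open>simp add: power2_eq_square mult_left_le\<close>)
  then show ?thesis using nsum_weight by linarith
qed

text \<open>Positive definiteness with g = \<mu> bounds \<open>energy\<^sup>2\<close> by a weighted
  sum of the correlations \<open>R \<alpha>\<close>. For fixed \<alpha>, a second use with
  \<open>g c = \<mu> c * \<mu> (c + \<alpha>)\<close> doubles the pair (c, c + \<alpha>) into a
  parallelogram, at the cost of a fourth power of \<open>R \<alpha>\<close>. Hence the exponent 2 *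
  4.\<close>

lemma square_counts_ge: "energy ^ 8 \<le> wsum (\<lambda>\<alpha>. wsum (\<lambda>\<beta>. square_count \<alpha> \<beta>))"
proof -
  define R where "R \<alpha> = nsum (\<lambda>c. \<mu> c * \<mu> (c + \<alpha>))" for \<alpha>
  have R_nonneg: "R \<alpha> \<ge> 0" for \<alpha>
    by (auto simp: R_def nonneg intro!: nsum_nonneg)
  have "energy\<^sup>2 = (nsum (\<lambda>v. \<mu> v * \<mu> v))\<^sup>2"
    by (simp add: energy_def power2_eq_square)
  also have "\<dots> \<le> nsum (\<lambda>c. nsum (\<lambda>d. \<mu> c * \<mu> d * \<mu> (c - d)))"
    by (rule pos_def_nsum)
  also have "\<dots> = nsum (\<lambda>d. nsum (\<lambda>c. \<mu> (c + d) * \<mu> d * \<mu> c))"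
  proof (subst nsum_swap, rule arg_cong [of _ _ nsum], rule ext)
    fix d
    show "nsum (\<lambda>c. \<mu> c * \<mu> d * \<mu> (c - d)) = nsum (\<lambda>c. \<mu> (c + d) * \<mu> d * \<mu> c)"
      using nsum_translate [of "\<lambda>c. \<mu> c * \<mu> d * \<mu> (c - d)" d] by simp
  qed
  also have "\<dots> = wsum R"
    by (simp add: wsum_def R_def nsum_mult_left ac_simps)
  finally have triangle: "energy\<^sup>2 \<le> wsum R" .
  \<comment> \<open>One factor serves as a measure of mass at most 1, so the other gets squared; the
    extra \<open>\<mu> c\<close> is the weight that \<open>pos_def_nsum\<close> requires.\<close>
  have R_sq: "(R \<alpha>)\<^sup>2 \<le> nsum (\<lambda>c. \<mu> c * \<mu> (c + \<alpha>) * \<mu> c)" for \<alpha>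
  proof -
    have "(R \<alpha>)\<^sup>2 = (nsum (\<lambda>c. \<mu> (c + \<alpha>) * \<mu> c))\<^sup>2"
      by (simp add: R_def mult.commute)
    also have "\<dots> \<le> nsum (\<lambda>c. \<mu> (c + \<alpha>)) * nsum (\<lambda>c. \<mu> (c + \<alpha>) * (\<mu> c)\<^sup>2)"
      by (rule nsum_Cauchy_Schwarz) (rule nonneg)
    also have "\<dots> \<le> 1 * nsum (\<lambda>c. \<mu> (c + \<alpha>) * (\<mu> c)\<^sup>2)"
      by (intro mult_right_mono nsum_weight_translate nsum_nonneg) (simp add: nonneg)
    finally show ?thesis
      by (simp add: power2_eq_square ac_simps)
  qed
  have square: "(R \<alpha>) ^ 4 \<le> wsum (\<lambda>\<beta>. square_count \<alpha> \<beta>)" for \<alpha>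
  proof -
    let ?g = "\<lambda>c. \<mu> c * \<mu> (c + \<alpha>)"
    have "(R \<alpha>) ^ 4 = ((R \<alpha>)\<^sup>2)\<^sup>2"
      by simp
    also have "\<dots> \<le> (nsum (\<lambda>c. ?g c * \<mu> c))\<^sup>2"
      by (rule power_mono [OF R_sq]) simp
    also have "\<dots> \<le> nsum (\<lambda>c. nsum (\<lambda>d. ?g c * ?g d * \<mu> (c - d)))"
      by (rule pos_def_nsum)
    also have "\<dots> = nsum (\<lambda>c. nsum (\<lambda>\<beta>. ?g c * ?g (\<beta> + c) * \<mu> \<beta>))"
    proof (rule arg_cong [of _ _ nsum], rule ext)
      fix c
      have "nsum (\<lambda>d. ?g c * ?g d * \<mu> (c - d)) = nsum (\<lambda>\<beta>. ?g c * ?g (\<beta> + c) * \<mu> (c - (\<beta> + c)))"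
        using nsum_translate [of "\<lambda>d. ?g c * ?g d * \<mu> (c - d)" c] by simp
      then show "nsum (\<lambda>d. ?g c * ?g d * \<mu> (c - d)) = nsum (\<lambda>\<beta>. ?g c * ?g (\<beta> + c) * \<mu> \<beta>)"
        by (simp add: even)
    qed
    also have "\<dots> = wsum (\<lambda>\<beta>. square_count \<alpha> \<beta>)"
      by (subst nsum_swap) (simp add: wsum_def square_count_def nsum_mult_left ac_simps)
    finally show ?thesis .
  qed
  have "energy ^ 8 = ((energy\<^sup>2)\<^sup>2)\<^sup>2"
    by simp
  also have "\<dots> \<le> ((wsum R)\<^sup>2)\<^sup>2"
    by (intro power_mono triangle) simp_all
  also have "\<dots> \<le> (wsum (\<lambda>\<alpha>. (R \<alpha>)\<^sup>2))\<^sup>2"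
    by (intro power_mono wsum_square_le) simp
  also have "\<dots> \<le> wsum (\<lambda>\<alpha>. ((R \<alpha>)\<^sup>2)\<^sup>2)"
    by (rule wsum_square_le)
  also have "\<dots> \<le> wsum (\<lambda>\<alpha>. wsum (\<lambda>\<beta>. square_count \<alpha> \<beta>))"
    by (rule wsum_mono) (use square in simp)
  finally show ?thesis .
qed

section \<open>The step kernel and its chains\<close>

text \<open>
  A step of the chain goes from \<open>y\<close> to \<open>y'\<close> through \<open>(b, b')\<close>. Setting arguments of \<open>\<mu>\<close> to \<open>0\<close>,
  the choice \<open>b = b' = y + v\<close> with \<open>y' = b + b' - v\<close> or \<open>y' = b + b'\<close> replaces \<open>y + v\<close> by \<open>2 (y + v)\<close>
  or \<open>2 (y + v) + v\<close>, and \<open>b = y + v\<close> with \<open>y' = b - v\<close> leaves it unchanged.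
\<close>

definition half_kernel :: "'v \<Rightarrow> 'v \<Rightarrow> 'v \<Rightarrow> 'v \<Rightarrow> real" where
  "half_kernel v b b' y =
     \<mu> (y + v - b) * \<mu> (y + v - b') * \<mu> (y - b - b') * \<mu> (y + v - b - b')"

text \<open>Sharing (b, b') between two copies of one half makes the kernel symmetric, as
  \<open>chain_double\<close> needs, and turns its quadratic form into a weighted sum of squares, as
  \<open>chain_one_ge\<close> needs.\<close>

definition step_kernel :: "'v \<Rightarrow> 'v \<Rightarrow> 'v \<Rightarrow> real" where
  "step_kernel v y y' = wsum (\<lambda>b. wsum (\<lambda>b'. half_kernel v b b' y * half_kernel v b b' y'))"

definition kernel_op :: "'v \<Rightarrow> ('v \<Rightarrow> real) \<Rightarrow> 'v \<Rightarrow> real" where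
  "kernel_op v h y = nsum (\<lambda>y'. step_kernel v y y' * h y')"

text \<open>The vector at both ends of a chain. At the start \<open>\<mu> y\<close> is kept, which
  makes y an independent variable; at the end \<open>\<mu> (y + v)\<close> is kept, which becomes
  the weight of the shifted dilate of v.\<close>

definition endpoint :: "'v \<Rightarrow> 'v \<Rightarrow> real" where
  "endpoint v y = \<mu> y * \<mu> (y + v)"

definition chain :: "nat \<Rightarrow> real" where
  "chain m = wsum (\<lambda>v. nsum (\<lambda>y. endpoint v y * (kernel_op v ^^ m) (endpoint v) y))"

lemma endpoint_nonneg: "endpoint v y \<ge> 0"
  by (simp add: endpoint_def nonneg)

lemma half_kernel_nonneg: "half_kernel v b b' y \<ge> 0"
  by (simp add: half_kernel_def nonneg)

lemma step_kernel_nonneg: "step_kernel v y y' \<ge> 0"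
  by (auto simp: step_kernel_def half_kernel_nonneg intro!: wsum_nonneg)

lemma kernel_op_nonneg: "(\<And>y. h y \<ge> 0) \<Longrightarrow> kernel_op v h y \<ge> 0"
  by (auto simp: kernel_op_def step_kernel_nonneg intro!: nsum_nonneg)

lemma kernel_op_power_nonneg: "(kernel_op v ^^ m) (endpoint v) y \<ge> 0"
  by (induction m arbitrary: y) (auto intro: kernel_op_nonneg endpoint_nonneg)

lemma step_kernel_sym: "step_kernel v y y' = step_kernel v y' y"
  by (simp add: step_kernel_def mult.commute)

lemma kernel_op_adjoint:
  "nsum (\<lambda>y. g y * kernel_op v h y) = nsum (\<lambda>y. kernel_op v g y * h y)"
proof -
  have "nsum (\<lambda>y. g y * kernel_op v h y) = nsum (\<lambda>y. nsum (\<lambda>y'. g y * (step_kernel v y y' * h y')))"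
    by (simp add: kernel_op_def nsum_mult_left)
  also have "\<dots> = nsum (\<lambda>y'. nsum (\<lambda>y. step_kernel v y' y * g y * h y'))"
    by (subst nsum_swap) (simp add: step_kernel_sym ac_simps)
  finally show ?thesis
    by (simp add: kernel_op_def nsum_mult_right)
qed

lemma kernel_op_power_adjoint:
  "nsum (\<lambda>y. g y * (kernel_op v ^^ m) h y) = nsum (\<lambda>y. (kernel_op v ^^ m) g y * h y)"
proof (induction m arbitrary: g)
  case (Suc m)
  have "nsum (\<lambda>y. g y * (kernel_op v ^^ Suc m) h y)
      = nsum (\<lambda>y. kernel_op v g y * (kernel_op v ^^ m) h y)"
    by (simp add: kernel_op_adjoint)
  then show ?case
    by (simp add: Suc funpow_swap1)
qed simp

text \<open>Write K for the operator and \<phi> for the endpoint vector. Since K is self-adjoint,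
  the square of <\<phi>, K^m \<phi>> is at most |\<phi>|^2 <\<phi>, K^(2m) \<phi>>, and |\<phi>|^2
  is at most the mass because \<phi>(y)^2 is at most \<open>\<mu> y\<close>. Another Cauchy-Schwarz
  handles the sum over v.\<close>

lemma chain_double: "(chain m)\<^sup>2 \<le> chain (m + m)"
proof -
  let ?\<phi> = endpoint
  let ?K = "\<lambda>v. (kernel_op v ^^ m) (endpoint v)"
  have square: "nsum (\<lambda>y. ?K v y * ?K v y) = nsum (\<lambda>y. ?\<phi> v y * (kernel_op v ^^ (m + m)) (?\<phi> v) y)" for v
    by (subst kernel_op_power_adjoint [symmetric]) (simp add: funpow_add)
  have norm: "nsum (\<lambda>y. (?\<phi> v y)\<^sup>2) \<le> 1" for v
  proof -
    have "(?\<phi> v y)\<^sup>2 \<le> \<mu> y" for y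
    proof -
      have "?\<phi> v y \<le> \<mu> y" "?\<phi> v y \<le> 1"
        using nonneg le_one by (auto simp: endpoint_def mult_left_le intro: mult_le_one)
      then show ?thesis
        using mult_mono [of "?\<phi> v y" "\<mu> y" "?\<phi> v y" 1] endpoint_nonneg nonneg
        by (simp add: power2_eq_square)
    qed
    then have "nsum (\<lambda>y. (?\<phi> v y)\<^sup>2) \<le> nsum \<mu>"
      by (rule nsum_mono)
    then show ?thesis using nsum_weight by linarith
  qed
  have inner: "(nsum (\<lambda>y. ?\<phi> v y * ?K v y))\<^sup>2 \<le> nsum (\<lambda>y. ?K v y * ?K v y)" for v
  proof -
    have "(\<Sum>y\<in>UNIV. ?\<phi> v y * ?K v y)\<^sup>2 \<le> (\<Sum>y\<in>UNIV. (?\<phi> v y)\<^sup>2) * (\<Sum>y\<in>UNIV. (?K v y)\<^sup>2)"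
      by (rule Cauchy_Schwarz_ineq_sum)
    then have "(nsum (\<lambda>y. ?\<phi> v y * ?K v y))\<^sup>2
        \<le> nsum (\<lambda>y. (?\<phi> v y)\<^sup>2) * nsum (\<lambda>y. (?K v y)\<^sup>2)"
      using N_pos by (simp add: nsum_def power_divide divide_right_mono flip: power2_eq_square)
    also have "\<dots> \<le> 1 * nsum (\<lambda>y. (?K v y)\<^sup>2)"
      by (intro mult_right_mono norm nsum_nonneg) simp
    finally show ?thesis
      by (simp add: power2_eq_square)
  qed
  have "(chain m)\<^sup>2 \<le> wsum (\<lambda>v. (nsum (\<lambda>y. ?\<phi> v y * ?K v y))\<^sup>2)"
    unfolding chain_def by (rule wsum_square_le)
  also have "\<dots> \<le> wsum (\<lambda>v. nsum (\<lambda>y. ?K v y * ?K v y))"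
    by (rule wsum_mono) (rule inner)
  finally show ?thesis
    by (simp add: chain_def square)
qed

lemma chain_nonneg: "chain m \<ge> 0"
  by (auto simp: chain_def endpoint_nonneg kernel_op_power_nonneg
      intro!: wsum_nonneg nsum_nonneg mult_nonneg_nonneg)

lemma chain_power: "(chain 1) ^ (2 ^ j) \<le> chain (2 ^ j)"
proof (induction j)
  case (Suc j)
  have "chain 1 ^ (2 ^ Suc j) = (chain 1 ^ (2 ^ j))\<^sup>2"
    by (simp add: power_mult [symmetric] mult.commute)
  also have "\<dots> \<le> (chain (2 ^ j))\<^sup>2"
    by (rule power_mono [OF Suc]) (simp add: chain_nonneg)
  also have "\<dots> \<le> chain (2 ^ Suc j)"
    using chain_double [of "2 ^ j"] by (simp add: mult_2)
  finally show ?case .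
qed simp

text \<open>
  The substitution \<open>\<beta> = y + v\<close>, \<open>\<alpha> = y + v - b - b'\<close> splits the nine factors of the weighted sum of
  \<open>X\<close> below into \<open>\<mu> \<alpha> * \<mu> \<beta>\<close>, a square and three corners of another square with sides \<open>\<alpha>\<close>, \<open>\<beta>\<close>.
\<close>

lemma chain_one_ge: "energy ^ 32 \<le> chain 1"
proof -
  define X where "X v b b' = nsum (\<lambda>y. endpoint v y * half_kernel v b b' y)" for v b b'
  define T where "T \<alpha> \<beta> = nsum (\<lambda>x. \<mu> x * \<mu> (x + \<alpha>) * \<mu> (x + \<beta>))" for \<alpha> \<beta>
  have chain_eq: "chain 1 = wsum (\<lambda>v. wsum (\<lambda>b. wsum (\<lambda>b'. (X v b b')\<^sup>2)))"
  proof -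
    have "nsum (\<lambda>y. endpoint v y * kernel_op v (endpoint v) y)
        = wsum (\<lambda>b. wsum (\<lambda>b'. (X v b b')\<^sup>2))" for v
    proof -
      have "nsum (\<lambda>y. endpoint v y * kernel_op v (endpoint v) y)
         = nsum (\<lambda>y. nsum (\<lambda>y'. wsum (\<lambda>b. wsum (\<lambda>b'.
             (endpoint v y * half_kernel v b b' y) * (endpoint v y' * half_kernel v b b' y')))))"
        by (simp add: kernel_op_def step_kernel_def wsum_def nsum_mult_left nsum_mult_right ac_simps)
      also have "\<dots> = wsum (\<lambda>b. wsum (\<lambda>b'. nsum (\<lambda>y. nsum (\<lambda>y'.
             (endpoint v y * half_kernel v b b' y) * (endpoint v y' * half_kernel v b b' y')))))"
        by (simp add: wsum_nsum_swap)
      also have "\<dots> = wsum (\<lambda>b. wsum (\<lambda>b'. (X v b b')\<^sup>2))"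
        unfolding X_def power2_eq_square nsum_mult_right by (simp only: nsum_mult_left)
      finally show ?thesis .
    qed
    then show ?thesis
      by (simp add: chain_def)
  qed
  have "wsum (\<lambda>v. wsum (\<lambda>b. wsum (\<lambda>b'. X v b b')))
      = nsum (\<lambda>y. nsum (\<lambda>v. nsum (\<lambda>b. nsum (\<lambda>b'.
          \<mu> v * \<mu> b * \<mu> b' * (endpoint v y * half_kernel v b b' y)))))"
  proof -
    have "wsum (\<lambda>v. wsum (\<lambda>b. wsum (\<lambda>b'. X v b b')))
      = nsum (\<lambda>y. wsum (\<lambda>v. wsum (\<lambda>b. wsum (\<lambda>b'. endpoint v y * half_kernel v b b' y))))"
      by (simp add: X_def wsum_nsum_swap)
    then show ?thesis
      by (simp add: wsum_def nsum_mult_left ac_simps)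
  qed
  also have "\<dots> = nsum (\<lambda>y. nsum (\<lambda>\<beta>. nsum (\<lambda>b. nsum (\<lambda>\<alpha>.
      \<mu> \<alpha> * \<mu> \<beta> * (\<mu> (\<beta> - y) * \<mu> (\<beta> - y - \<alpha>) * \<mu> y)
        * (\<mu> (\<beta> - b) * \<mu> (\<beta> - b - \<alpha>) * \<mu> b * \<mu> (b + \<alpha>))))))"
  proof (rule arg_cong [of _ _ nsum], rule ext)
    fix y
    let ?F = "\<lambda>v b b'. \<mu> v * \<mu> b * \<mu> b' * (endpoint v y * half_kernel v b b' y)"
    have F_eq: "?F (\<beta> - y) b (\<beta> - b - \<alpha>) = \<mu> \<alpha> * \<mu> \<beta> * (\<mu> (\<beta> - y) * \<mu> (\<beta> - y - \<alpha>) * \<mu> y)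
        * (\<mu> (\<beta> - b) * \<mu> (\<beta> - b - \<alpha>) * \<mu> b * \<mu> (b + \<alpha>))" for \<beta> b \<alpha>
      using even [of "\<beta> - y - \<alpha>"]
      by (simp add: endpoint_def half_kernel_def algebra_simps)
    have "nsum (\<lambda>v. nsum (\<lambda>b. nsum (\<lambda>b'. ?F v b b')))
        = nsum (\<lambda>\<beta>. nsum (\<lambda>b. nsum (\<lambda>b'. ?F (\<beta> - y) b b')))"
      using nsum_translate [of "\<lambda>v. nsum (\<lambda>b. nsum (\<lambda>b'. ?F v b b'))" "- y"] by simp
    also have "\<dots> = nsum (\<lambda>\<beta>. nsum (\<lambda>b. nsum (\<lambda>\<alpha>. ?F (\<beta> - y) b (\<beta> - b - \<alpha>))))"
    proof -
      have "nsum (\<lambda>b'. ?F (\<beta> - y) b b') = nsum (\<lambda>\<alpha>. ?F (\<beta> - y) b (\<beta> - b - \<alpha>))" for \<beta> b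
        by (rule nsum_reflect [symmetric])
      then show ?thesis by simp
    qed
    finally show "nsum (\<lambda>v. nsum (\<lambda>b. nsum (\<lambda>b'. ?F v b b'))) =
       nsum (\<lambda>\<beta>. nsum (\<lambda>b. nsum (\<lambda>\<alpha>.
      \<mu> \<alpha> * \<mu> \<beta> * (\<mu> (\<beta> - y) * \<mu> (\<beta> - y - \<alpha>) * \<mu> y)
        * (\<mu> (\<beta> - b) * \<mu> (\<beta> - b - \<alpha>) * \<mu> b * \<mu> (b + \<alpha>)))))"
      by (simp only: F_eq)
  qed
  also have "\<dots> = nsum (\<lambda>\<alpha>. nsum (\<lambda>\<beta>. nsum (\<lambda>y. nsum (\<lambda>b.
      \<mu> \<alpha> * \<mu> \<beta> * (\<mu> (\<beta> - y) * \<mu> (\<beta> - y - \<alpha>) * \<mu> y)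
        * (\<mu> (\<beta> - b) * \<mu> (\<beta> - b - \<alpha>) * \<mu> b * \<mu> (b + \<alpha>))))))"
    (is "nsum (\<lambda>y. nsum (\<lambda>\<beta>. nsum (\<lambda>b. nsum (\<lambda>\<alpha>. ?F \<alpha> \<beta> y b)))) = _")
  proof -
    have "nsum (\<lambda>y. nsum (\<lambda>\<beta>. nsum (\<lambda>b. nsum (\<lambda>\<alpha>. ?F \<alpha> \<beta> y b))))
        = nsum (\<lambda>y. nsum (\<lambda>\<beta>. nsum (\<lambda>\<alpha>. nsum (\<lambda>b. ?F \<alpha> \<beta> y b))))"
      by (subst (3) nsum_swap) (rule refl)
    also have "\<dots> = nsum (\<lambda>y. nsum (\<lambda>\<alpha>. nsum (\<lambda>\<beta>. nsum (\<lambda>b. ?F \<alpha> \<beta> y b))))"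
      by (subst (2) nsum_swap) (rule refl)
    also have "\<dots> = nsum (\<lambda>\<alpha>. nsum (\<lambda>y. nsum (\<lambda>\<beta>. nsum (\<lambda>b. ?F \<alpha> \<beta> y b))))"
      by (rule nsum_swap)
    also have "\<dots> = nsum (\<lambda>\<alpha>. nsum (\<lambda>\<beta>. nsum (\<lambda>y. nsum (\<lambda>b. ?F \<alpha> \<beta> y b))))"
      by (subst (2) nsum_swap) (rule refl)
    finally show ?thesis .
  qed
  \<comment> \<open>For fixed \<alpha> and \<beta> the variables y and b separate. Translation by
    \<beta> and evenness identify the y-sum with T and the b-sum with
    \<open>square_count\<close>.\<close>
  also have "\<dots> = wsum (\<lambda>\<alpha>. wsum (\<lambda>\<beta>. T \<alpha> \<beta> * square_count \<alpha> \<beta>))"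
  proof -
    have T_eq: "T \<alpha> \<beta> = nsum (\<lambda>y. \<mu> (\<beta> - y) * \<mu> (\<beta> - y - \<alpha>) * \<mu> y)" for \<alpha> \<beta>
    proof -
      have "T \<alpha> \<beta> = nsum (\<lambda>y. \<mu> (y + - \<beta>) * \<mu> (y + - \<beta> + \<alpha>) * \<mu> (y + - \<beta> + \<beta>))"
        unfolding T_def by (rule nsum_translate [symmetric])
      then show ?thesis
        using even [of "\<beta> - y" for y] even [of "\<beta> - y - \<alpha>" for y] by (simp add: algebra_simps)
    qed
    have Q_eq: "square_count \<alpha> \<beta> = nsum (\<lambda>b. \<mu> (\<beta> - b) * \<mu> (\<beta> - b - \<alpha>) * \<mu> b * \<mu> (b + \<alpha>))" for \<alpha> \<beta>
    proof -
      have "square_count \<alpha> \<beta> = nsum (\<lambda>y. \<mu> (y + - \<beta>) * \<mu> (y + - \<beta> + \<alpha>) * \<mu> (y + - \<beta> + \<beta>) * \<mu> (y + - \<beta> + \<alpha> + \<beta>))"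
        unfolding square_count_def by (rule nsum_translate [symmetric])
      then show ?thesis
        using even [of "\<beta> - y" for y] even [of "\<beta> - y - \<alpha>" for y] by (simp add: algebra_simps)
    qed
    have "T \<alpha> \<beta> * square_count \<alpha> \<beta> = nsum (\<lambda>y. nsum (\<lambda>b.
        (\<mu> (\<beta> - y) * \<mu> (\<beta> - y - \<alpha>) * \<mu> y)
          * (\<mu> (\<beta> - b) * \<mu> (\<beta> - b - \<alpha>) * \<mu> b * \<mu> (b + \<alpha>))))" for \<alpha> \<beta>
      unfolding T_eq Q_eq nsum_mult_right by (simp only: nsum_mult_left)
    then show ?thesis
      by (simp add: wsum_def nsum_mult_left mult.assoc)
  qed
  finally have X_eq: "wsum (\<lambda>v. wsum (\<lambda>b. wsum (\<lambda>b'. X v b b')))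
      = wsum (\<lambda>\<alpha>. wsum (\<lambda>\<beta>. T \<alpha> \<beta> * square_count \<alpha> \<beta>))" .
  \<comment> \<open>One of two squares gives up its fourth corner, since X supplies only seven
    corner factors besides the two sides.\<close>
  have T_ge: "square_count \<alpha> \<beta> \<le> T \<alpha> \<beta>" for \<alpha> \<beta>
    unfolding square_count_def T_def
    by (rule nsum_mono) (simp add: nonneg le_one mult_left_le)
  have "energy ^ 16 = (energy ^ 8)\<^sup>2"
    by simp
  also have "\<dots> \<le> (wsum (\<lambda>\<alpha>. wsum (\<lambda>\<beta>. square_count \<alpha> \<beta>)))\<^sup>2"
    by (rule power_mono [OF square_counts_ge]) (simp add: energy_nonneg)
  also have "\<dots> \<le> wsum (\<lambda>\<alpha>. (wsum (\<lambda>\<beta>. square_count \<alpha> \<beta>))\<^sup>2)"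
    by (rule wsum_square_le)
  also have "\<dots> \<le> wsum (\<lambda>\<alpha>. wsum (\<lambda>\<beta>. (square_count \<alpha> \<beta>)\<^sup>2))"
    by (rule wsum_mono) (rule wsum_square_le)
  also have "\<dots> \<le> wsum (\<lambda>\<alpha>. wsum (\<lambda>\<beta>. T \<alpha> \<beta> * square_count \<alpha> \<beta>))"
    by (intro wsum_mono) (simp add: power2_eq_square mult_right_mono T_ge square_count_nonneg)
  finally have I16: "energy ^ 16 \<le> wsum (\<lambda>v. wsum (\<lambda>b. wsum (\<lambda>b'. X v b b')))"
    by (simp only: X_eq)
  have "energy ^ 32 = (energy ^ 16)\<^sup>2"
    by simp
  also have "\<dots> \<le> (wsum (\<lambda>v. wsum (\<lambda>b. wsum (\<lambda>b'. X v b b'))))\<^sup>2"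
    by (rule power_mono [OF I16]) (simp add: energy_nonneg)
  also have "\<dots> \<le> wsum (\<lambda>v. (wsum (\<lambda>b. wsum (\<lambda>b'. X v b b')))\<^sup>2)"
    by (rule wsum_square_le)
  also have "\<dots> \<le> wsum (\<lambda>v. wsum (\<lambda>b. (wsum (\<lambda>b'. X v b b'))\<^sup>2))"
    by (intro wsum_mono wsum_square_le)
  also have "\<dots> \<le> wsum (\<lambda>v. wsum (\<lambda>b. wsum (\<lambda>b'. (X v b b')\<^sup>2)))"
    by (intro wsum_mono wsum_square_le)
  finally show ?thesis
    by (simp only: chain_eq)
qed

section \<open>Steering a chain along the binary digits of the multiplier\<close>

text \<open>The three retained weights determine b, b' and y' up to errors s = p - b, t = q - b' and
  u = y' - r(b, b'). Taking these errors as the new variables makes the weights independent; y' is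
  substituted first because its target depends on b and b'.\<close>

lemma kernel_op_le:
  assumes h: "\<And>y. h y \<ge> 0"
    and le: "\<And>b b' y'. \<mu> b * \<mu> b' * (half_kernel v b b' y * half_kernel v b b' y')
      \<le> \<mu> (p - b) * \<mu> (q - b') * \<mu> (y' - r b b')"
  shows "kernel_op v h y \<le> wsum (\<lambda>s. wsum (\<lambda>t. wsum (\<lambda>u. h (u + r (p - s) (q - t)))))"
proof -
  have "kernel_op v h y = nsum (\<lambda>y'. nsum (\<lambda>b. nsum (\<lambda>b'.
      \<mu> b * \<mu> b' * (half_kernel v b b' y * half_kernel v b b' y') * h y')))"
    by (simp add: kernel_op_def step_kernel_def wsum_def nsum_mult_left nsum_mult_right ac_simps)
  also have "\<dots> \<le> nsum (\<lambda>y'. nsum (\<lambda>b. nsum (\<lambda>b'. \<mu> (p - b) * \<mu> (q - b') * \<mu> (y' - r b b') * h y')))"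
    (is "_ \<le> nsum (\<lambda>y'. nsum (\<lambda>b. nsum (\<lambda>b'. ?F y' b b')))")
    by (intro nsum_mono mult_right_mono le h)
  also have "\<dots> = nsum (\<lambda>b. nsum (\<lambda>y'. nsum (\<lambda>b'. ?F y' b b')))"
    by (rule nsum_swap)
  also have "\<dots> = nsum (\<lambda>b. nsum (\<lambda>b'. nsum (\<lambda>y'. ?F y' b b')))"
    by (subst (2) nsum_swap) (rule refl)
  also have "\<dots> = nsum (\<lambda>b. nsum (\<lambda>b'. nsum (\<lambda>u. ?F (u + r b b') b b')))"
  proof -
    have "nsum (\<lambda>y'. ?F y' b b') = nsum (\<lambda>u. ?F (u + r b b') b b')" for b b'
      by (rule nsum_translate [symmetric])
    then show ?thesis by simp
  qed
  also have "\<dots> = nsum (\<lambda>s. nsum (\<lambda>b'. nsum (\<lambda>u. ?F (u + r (p - s) b') (p - s) b')))"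
    by (rule nsum_reflect [symmetric])
  also have "\<dots> = nsum (\<lambda>s. nsum (\<lambda>t. nsum (\<lambda>u. ?F (u + r (p - s) (q - t)) (p - s) (q - t))))"
  proof (rule arg_cong [of _ _ nsum], rule ext)
    fix s
    show "nsum (\<lambda>b'. nsum (\<lambda>u. ?F (u + r (p - s) b') (p - s) b')) =
        nsum (\<lambda>t. nsum (\<lambda>u. ?F (u + r (p - s) (q - t)) (p - s) (q - t)))"
      by (rule nsum_reflect [symmetric])
  qed
  finally show ?thesis
    by (simp add: wsum_def nsum_mult_left ac_simps)
qed

lemma mult_weight_le: "a \<ge> 0 \<Longrightarrow> a * \<mu> x \<le> a"
  using le_one by (rule mult_left_le)

text \<open>All factors are at most 1, so any of them may be dropped; these selections are the ones
  used by the three moves of the chain.\<close>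

lemma half_kernel_le:
  "half_kernel v b b' y \<le> \<mu> (y + v - b) * \<mu> (y + v - b')"
  "half_kernel v b b' y \<le> \<mu> (y + v - b)"
  "half_kernel v b b' y \<le> \<mu> (y - b - b')"
  "half_kernel v b b' y \<le> \<mu> (y + v - b - b')"
proof -
  let ?p = "\<mu> (y + v - b)" and ?q = "\<mu> (y + v - b')"
    and ?r = "\<mu> (y - b - b')" and ?s = "\<mu> (y + v - b - b')"
  have "half_kernel v b b' y \<le> ?p * ?q * ?r"
    unfolding half_kernel_def by (rule mult_weight_le) (simp add: nonneg)
  also have "\<dots> \<le> ?p * ?q"
    by (rule mult_weight_le) (simp add: nonneg)
  finally show pq: "half_kernel v b b' y \<le> ?p * ?q" .
  also have "\<dots> \<le> ?p"
    by (rule mult_weight_le) (rule nonneg)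
  finally show "half_kernel v b b' y \<le> ?p" .
  have "?p * ?q \<le> 1" "?p * ?q * ?r \<le> 1"
    by (simp_all add: mult_le_one nonneg le_one)
  then show "half_kernel v b b' y \<le> ?r" "half_kernel v b b' y \<le> ?s"
    unfolding half_kernel_def
    using mult_right_mono [of "?p * ?q" 1 ?r] mult_weight_le [of "?p * ?q * ?r" "y + v - b - b'"]
      mult_right_mono [of "?p * ?q * ?r" 1 ?s] by (simp_all add: nonneg)
qed

text \<open>With the errors s, t, u summed outermost they are constants for the sum over v, so a
  bound uniform in them suffices. \<open>S \<ge> 0\<close> is used because the weights may have mass
  below 1.\<close>

lemma weighted_kernel_op_le:
  assumes S: "S \<ge> 0"
    and h: "\<And>v y. h v y \<ge> 0"
    and le: "\<And>v b b' y'. \<mu> b * \<mu> b' * (half_kernel v b b' (y v) * half_kernel v b b' y')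
      \<le> \<mu> (p v - b) * \<mu> (q v - b') * \<mu> (y' - r v b b')"
    and bound: "\<And>s t u. wsum (\<lambda>v. h v (u + r v (p v - s) (q v - t))) \<le> S"
  shows "wsum (\<lambda>v. kernel_op v (h v) (y v)) \<le> S"
proof -
  let ?H = "\<lambda>s t u v. h v (u + r v (p v - s) (q v - t))"
  have "wsum (\<lambda>v. kernel_op v (h v) (y v))
      \<le> wsum (\<lambda>v. wsum (\<lambda>s. wsum (\<lambda>t. wsum (\<lambda>u. ?H s t u v))))"
    by (intro wsum_mono kernel_op_le h le)
  also have "\<dots> = wsum (\<lambda>s. wsum (\<lambda>v. wsum (\<lambda>t. wsum (\<lambda>u. ?H s t u v))))"
    by (rule wsum_swap)
  also have "\<dots> = wsum (\<lambda>s. wsum (\<lambda>t. wsum (\<lambda>v. wsum (\<lambda>u. ?H s t u v))))"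
    by (subst (2) wsum_swap) (rule refl)
  also have "\<dots> = wsum (\<lambda>s. wsum (\<lambda>t. wsum (\<lambda>u. wsum (\<lambda>v. ?H s t u v))))"
    by (subst (3) wsum_swap) (rule refl)
  also have "\<dots> \<le> S"
    by (intro wsum_le S bound)
  finally show ?thesis .
qed

text \<open>
  The state is \<open>y = b v - v + c\<close>. Each step discards all factors except the three that prescribe
  \<open>b\<close>, \<open>b'\<close> and \<open>y'\<close>; these become independent weights of total mass at most \<open>1\<close> and only affect \<open>c\<close>.
\<close>

lemma kernel_op_power_le:
  assumes S: "\<And>c. wsum (\<lambda>v. \<mu> (nat_mult a v + c)) \<le> S"
    and "b * 2 ^ k \<le> a" "a < (b + 1) * 2 ^ k" "k \<le> m"
  shows "wsum (\<lambda>v. (kernel_op v ^^ m) (endpoint v) (nat_mult b v - v + c)) \<le> S"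
  using assms(2-)
\<comment> \<open>The bounds on a say that b is a with its last k binary digits removed. Each step
  appends one digit while k is positive; the remaining steps leave b alone.\<close>
proof (induction m arbitrary: b k c)
  case 0
  then have "a = b" by simp
  have "wsum (\<lambda>v. endpoint v (nat_mult b v - v + c)) \<le> wsum (\<lambda>v. \<mu> (nat_mult a v + c))"
    by (rule wsum_mono) (simp add: endpoint_def \<open>a = b\<close> algebra_simps mult_left_le nonneg le_one)
  also have "\<dots> \<le> S" by (rule S)
  finally show ?case by simp
next
  case (Suc m)
  have S0: "S \<ge> 0"
    using S [of 0] wsum_nonneg [of "\<lambda>v. \<mu> (nat_mult a v + 0)"] nonneg by force
  let ?h = "\<lambda>v. (kernel_op v ^^ m) (endpoint v)"
  let ?y = "\<lambda>v. nat_mult b v - v + c"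
  show ?case
  proof (cases k)
    case 0
    with Suc.prems have IH: "wsum (\<lambda>v. ?h v (nat_mult b v - v + c')) \<le> S" for c'
      by (intro Suc.IH [of b 0]) auto
    have "wsum (\<lambda>v. kernel_op v (?h v) (?y v)) \<le> S"
    proof (rule weighted_kernel_op_le [OF S0 kernel_op_power_nonneg,
          where p = "\<lambda>v. ?y v + v" and q = "\<lambda>_. 0" and r = "\<lambda>v b b'. b - v"])
      fix v b b' y'
      show "\<mu> b * \<mu> b' * (half_kernel v b b' (?y v) * half_kernel v b b' y')
          \<le> \<mu> (?y v + v - b) * \<mu> (0 - b') * \<mu> (y' - (b - v))"
      proof -
        have "\<mu> b * \<mu> b' * (half_kernel v b b' (?y v) * half_kernel v b b' y')
            \<le> (1 * \<mu> b') * (\<mu> (?y v + v - b) * \<mu> (y' + v - b))"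
          by (intro mult_mono half_kernel_le le_one order_refl mult_nonneg_nonneg
              half_kernel_nonneg nonneg) simp_all
        then show ?thesis
          by (simp add: even algebra_simps)
      qed
      show "wsum (\<lambda>v. ?h v (u + ((?y v + v - s) - v))) \<le> S" for s u
        using IH [of "u + c - s"] by (simp add: algebra_simps)
    qed
    then show ?thesis by simp
  next
    case (Suc k')
    show ?thesis
    \<comment> \<open>The next digit is 0 in this case and 1 otherwise; the extra v for a digit 1
      comes from omitting \<open>- v\<close> in r.\<close>
    proof (cases "a < (2 * b + 1) * 2 ^ k'")
      case True
      then have "wsum (\<lambda>v. ?h v (nat_mult (2 * b) v - v + c')) \<le> S" for c'
        using Suc.prems \<open>k = Suc k'\<close> by (intro Suc.IH [of "2 * b" k']) auto
      then have IH: "wsum (\<lambda>v. ?h v (nat_mult b v + nat_mult b v - v + c')) \<le> S" for c'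
        by (simp only: mult_2 nat_mult_add)
      have "wsum (\<lambda>v. kernel_op v (?h v) (?y v)) \<le> S"
      proof (rule weighted_kernel_op_le [OF S0 kernel_op_power_nonneg,
            where p = "\<lambda>v. ?y v + v" and q = "\<lambda>v. ?y v + v" and r = "\<lambda>v b b'. b + b' - v"])
        fix v b b' y'
        show "\<mu> b * \<mu> b' * (half_kernel v b b' (?y v) * half_kernel v b b' y')
            \<le> \<mu> (?y v + v - b) * \<mu> (?y v + v - b') * \<mu> (y' - (b + b' - v))"
        proof -
          have "\<mu> b * \<mu> b' * (half_kernel v b b' (?y v) * half_kernel v b b' y')
              \<le> 1 * 1 * ((\<mu> (?y v + v - b) * \<mu> (?y v + v - b')) * \<mu> (y' + v - b - b'))"
            by (intro mult_mono half_kernel_le le_one mult_nonneg_nonneg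
                half_kernel_nonneg nonneg) simp_all
          then show ?thesis
            by (simp add: algebra_simps)
        qed
        show "wsum (\<lambda>v. ?h v (u + ((?y v + v - s) + (?y v + v - t) - v))) \<le> S" for s t u
          using IH [of "u + c + c - s - t"] by (simp add: algebra_simps)
      qed
      then show ?thesis by simp
    next
      case False
      then have "wsum (\<lambda>v. ?h v (nat_mult (Suc (2 * b)) v - v + c')) \<le> S" for c'
        using Suc.prems \<open>k = Suc k'\<close> by (intro Suc.IH [of "Suc (2 * b)" k']) auto
      then have IH: "wsum (\<lambda>v. ?h v (v + (nat_mult b v + nat_mult b v) - v + c')) \<le> S" for c'
        by (simp only: mult_2 nat_mult_add nat_mult.simps)
      have "wsum (\<lambda>v. kernel_op v (?h v) (?y v)) \<le> S"
      proof (rule weighted_kernel_op_le [OF S0 kernel_op_power_nonneg,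
            where p = "\<lambda>v. ?y v + v" and q = "\<lambda>v. ?y v + v" and r = "\<lambda>v b b'. b + b'"])
        fix v b b' y'
        show "\<mu> b * \<mu> b' * (half_kernel v b b' (?y v) * half_kernel v b b' y')
            \<le> \<mu> (?y v + v - b) * \<mu> (?y v + v - b') * \<mu> (y' - (b + b'))"
        proof -
          have "\<mu> b * \<mu> b' * (half_kernel v b b' (?y v) * half_kernel v b b' y')
              \<le> 1 * 1 * ((\<mu> (?y v + v - b) * \<mu> (?y v + v - b')) * \<mu> (y' - b - b'))"
            by (intro mult_mono half_kernel_le le_one mult_nonneg_nonneg
                half_kernel_nonneg nonneg) simp_all
          then show ?thesis
            by (simp add: algebra_simps)
        qed
        show "wsum (\<lambda>v. ?h v (u + ((?y v + v - s) + (?y v + v - t)))) \<le> S" for s t u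
          using IH [of "u + c + c - s - t"] by (simp add: algebra_simps)
      qed
      then show ?thesis by simp
    qed
  qed
qed

lemma chain_le:
  assumes S: "\<And>c. wsum (\<lambda>v. \<mu> (nat_mult a v + c)) \<le> S"
    and "2 ^ k \<le> a" "a < 2 ^ Suc k" "k \<le> m"
  shows "chain m \<le> S"
proof -
  have S0: "S \<ge> 0"
    using S [of 0] wsum_nonneg [of "\<lambda>v. \<mu> (nat_mult a v + 0)"] nonneg by force
  let ?K = "\<lambda>v. (kernel_op v ^^ m) (endpoint v)"
  have "chain m \<le> wsum (\<lambda>v. wsum (\<lambda>y. ?K v y))"
    unfolding chain_def wsum_def
    by (intro nsum_mono mult_left_mono nonneg mult_right_mono kernel_op_power_nonneg)
      (simp add: endpoint_def mult_left_le nonneg le_one)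
  also have "\<dots> = wsum (\<lambda>y. wsum (\<lambda>v. ?K v y))"
    by (rule wsum_swap)
  also have "\<dots> \<le> S"
  proof (rule wsum_le [OF S0])
    fix y
    show "wsum (\<lambda>v. ?K v y) \<le> S"
      \<comment> \<open>The start y equals \<open>nat_mult 1 v - v + y\<close>: the leading digit is
        already in place and y acts as the shift.\<close>
      using kernel_op_power_le [of a S 1 k m y] assms by simp
  qed
  finally show ?thesis .
qed

theorem energy_power_le:
  assumes "\<And>c. wsum (\<lambda>v. \<mu> (nat_mult a v + c)) \<le> S"
    and "2 ^ k \<le> a" "a < 2 ^ Suc k" "k \<le> 2 ^ j"
  shows "energy ^ (32 * 2 ^ j) \<le> S"
proof -
  have "energy ^ (32 * 2 ^ j) \<le> chain 1 ^ (2 ^ j)"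
    unfolding power_mult by (rule power_mono [OF chain_one_ge]) (simp add: energy_nonneg)
  also have "\<dots> \<le> chain (2 ^ j)"
    by (rule chain_power)
  also have "\<dots> \<le> S"
    by (rule chain_le [OF assms])
  finally show ?thesis .
qed

end

section \<open>Fourier analysis on a finite self-dual group\<close>

lemma nat_mult_Pair: "nat_mult n (x, y) = (nat_mult n x, nat_mult n y)"
  by (induction n) (auto simp: zero_prod_def)

text \<open>A symmetric bicharacter, nondegenerate by the orthogonality relation
  \<open>e_sum\<close>; it identifies the group with its dual, so frequencies are group
  elements.\<close>

locale self_dual_group =
  fixes e :: "'g::{ab_group_add,finite} \<Rightarrow> 'g \<Rightarrow> complex"
  assumes e_add_left: "e (x + y) r = e x r * e y r"
    and e_sym: "e x r = e r x"
    and norm_e: "norm (e x r) = 1"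
    and e_sum: "(\<Sum>r\<in>UNIV. e x r) = (if x = 0 then of_nat CARD('g) else 0)"
begin

lemma e_add_right: "e x (r + s) = e x r * e x s"
  by (metis e_add_left e_sym)

lemma e_cnj_self: "e x r * cnj (e x r) = 1"
  using norm_e [of x r] by (simp flip: complex_norm_square)

lemma e_zero_left: "e 0 r = 1"
proof -
  have "e 0 r * e 0 r = e 0 r * 1"
    using e_add_left [of 0 0 r] by simp
  moreover have "e 0 r \<noteq> 0"
    using norm_e [of 0 r] by auto
  ultimately show ?thesis
    using mult_left_cancel by blast
qed

lemma e_minus_left: "e (- x) r = cnj (e x r)"
proof -
  have "e x r * e (- x) r = e x r * cnj (e x r)"
    using e_add_left [of x "- x" r] by (simp add: e_zero_left e_cnj_self)
  moreover have "e x r \<noteq> 0"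
    using norm_e [of x r] by auto
  ultimately show ?thesis
    using mult_left_cancel by blast
qed

lemma e_minus_right: "e x (- r) = cnj (e x r)"
  by (metis e_minus_left e_sym)

lemma e_nat_mult: "e (nat_mult n x) r = e x (nat_mult n r)"
proof (induction n)
  case 0
  show ?case
    by (simp add: e_zero_left e_sym [of x 0])
next
  case (Suc n)
  then show ?case
    by (simp add: e_add_left e_add_right)
qed

definition weight :: "('g \<Rightarrow> complex) \<Rightarrow> 'g \<times> 'g \<Rightarrow> real" where
  "weight f = (\<lambda>(h, r). (norm (avg (\<lambda>x. f x * cnj (f (x + h)) * e x r)))\<^sup>2)"

lemma weight_nonneg: "weight f v \<ge> 0"
  by (simp add: weight_def split: prod.split)

lemma weight_le_one:
  assumes "one_bounded f"
  shows "weight f v \<le> 1"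
proof -
  obtain h r where v: "v = (h, r)"
    by (cases v)
  have "norm (f x * cnj (f (x + h)) * e x r) \<le> 1" for x
    using assms by (simp add: one_bounded_def norm_mult norm_e mult_le_one)
  then have "norm (\<Sum>x\<in>UNIV. f x * cnj (f (x + h)) * e x r) \<le> of_nat CARD('g) * 1"
    by (intro sum_norm_bound) auto
  then have "norm (avg (\<lambda>x. f x * cnj (f (x + h)) * e x r)) \<le> 1"
    by (simp add: avg_def norm_divide)
  then show ?thesis
    by (simp add: v weight_def power_le_one)
qed

text \<open>\<open>b_fun f h\<close> is the autocorrelation of
  \<open>g x = f x * cnj (f (x + h))\<close>, and the squared modulus of a Fourier transform inverts
  to the autocorrelation: orthogonality forces y = x + h'.\<close>

lemma b_fun_eq_weight_sum:
  "b_fun f h h' = (\<Sum>r\<in>UNIV. complex_of_real (weight f (h, r)) * e h' r)"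
proof -
  let ?N = "of_nat CARD('g) :: complex"
  define g where "g x = f x * cnj (f (x + h))" for x
  have w: "complex_of_real (weight f (h, r)) =
      (\<Sum>x\<in>UNIV. \<Sum>y\<in>UNIV. g x * cnj (g y) * e (x - y) r) / ?N\<^sup>2" for r
  proof -
    have "complex_of_real (weight f (h, r)) = avg (\<lambda>x. g x * e x r) * cnj (avg (\<lambda>x. g x * e x r))"
      unfolding weight_def g_def prod.case complex_norm_square by (rule refl)
    also have "\<dots> = (\<Sum>x\<in>UNIV. g x * e x r) * (\<Sum>y\<in>UNIV. cnj (g y * e y r)) / ?N\<^sup>2"
      by (simp add: avg_def power2_eq_square)
    also have "\<dots> = (\<Sum>x\<in>UNIV. \<Sum>y\<in>UNIV. g x * cnj (g y) * e (x - y) r) / ?N\<^sup>2"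
      using e_add_left [of x "- y" r for x y]
      by (simp add: sum_product e_minus_left ac_simps)
    finally show ?thesis .
  qed
  have "(\<Sum>r\<in>UNIV. complex_of_real (weight f (h, r)) * e h' r)
      = (\<Sum>r\<in>UNIV. \<Sum>x\<in>UNIV. \<Sum>y\<in>UNIV. g x * cnj (g y) * e (x - y + h') r) / ?N\<^sup>2"
    by (simp add: w sum_divide_distrib sum_distrib_right e_add_left mult.assoc)
  also have "\<dots> = (\<Sum>x\<in>UNIV. \<Sum>r\<in>UNIV. \<Sum>y\<in>UNIV. g x * cnj (g y) * e (x - y + h') r) / ?N\<^sup>2"
    by (subst sum.swap) (rule refl)
  also have "\<dots> = (\<Sum>x\<in>UNIV. \<Sum>y\<in>UNIV. \<Sum>r\<in>UNIV. g x * cnj (g y) * e (x - y + h') r) / ?N\<^sup>2"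
    by (subst (2) sum.swap) (rule refl)
  also have "\<dots> = (\<Sum>x\<in>UNIV. \<Sum>y\<in>UNIV. g x * cnj (g y) * (\<Sum>r\<in>UNIV. e (x - y + h') r)) / ?N\<^sup>2"
    by (simp add: sum_distrib_left)
  also have "\<dots> = (\<Sum>x\<in>UNIV. \<Sum>y\<in>UNIV. if y = x + h' then g x * cnj (g y) * ?N else 0) / ?N\<^sup>2"
  proof -
    have "x - y + h' = 0 \<longleftrightarrow> y = x + h'" for x y
      by (auto simp: algebra_simps)
    then show ?thesis
      by (simp add: e_sum if_distrib cong: if_cong)
  qed
  also have "\<dots> = avg (\<lambda>x. g x * cnj (g (x + h')))"
    by (simp add: avg_def power2_eq_square sum_divide_distrib)
  also have "\<dots> = b_fun f h h'"
    by (simp add: b_fun_def g_def ac_simps)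
  finally show ?thesis ..
qed

lemma b_fun_commute: "b_fun f h h' = b_fun f h' h"
  by (simp add: b_fun_def ac_simps)

section \<open>The symplectic pairing, self-duality and positive definiteness\<close>

definition pairing :: "'g \<times> 'g \<Rightarrow> 'g \<times> 'g \<Rightarrow> complex" where
  "pairing v w = e (fst v) (snd w) * cnj (e (fst w) (snd v))"

lemma pairing_add_left: "pairing (u + v) w = pairing u w * pairing v w"
  by (simp add: pairing_def e_add_left e_add_right)

lemma pairing_minus_left: "pairing (- v) w = cnj (pairing v w)"
  by (simp add: pairing_def e_minus_left e_minus_right)

lemma cnj_pairing: "cnj (pairing v w) = pairing w v"
  by (simp add: pairing_def mult.commute)

lemma norm_pairing: "norm (pairing v w) = 1"
  by (simp add: pairing_def norm_mult norm_e)

lemma pairing_nat_mult: "pairing (nat_mult n v) w = pairing v (nat_mult n w)"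
  by (cases v, cases w) (simp add: pairing_def nat_mult_Pair e_nat_mult)

text \<open>Summing over the frequency of w gives \<open>b_fun f k h\<close>; the symmetry of b
  exchanges k and h, and Fourier inversion in k returns the weight at (h, r).\<close>

lemma weight_self_dual:
  "complex_of_real (weight f v) =
     (\<Sum>w\<in>UNIV. complex_of_real (weight f w) * pairing v w) / of_nat CARD('g)"
proof -
  obtain h r where v: "v = (h, r)"
    by (cases v)
  have "(\<Sum>w\<in>UNIV. complex_of_real (weight f w) * pairing v w)
      = (\<Sum>k\<in>UNIV. \<Sum>s\<in>UNIV. complex_of_real (weight f (k, s)) * pairing v (k, s))"
    unfolding UNIV_Times_UNIV [symmetric] sum.cartesian_product by (simp add: split_def)
  also have "\<dots> = (\<Sum>k\<in>UNIV. b_fun f k h * cnj (e k r))"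
    by (simp add: b_fun_eq_weight_sum v pairing_def sum_distrib_right mult.assoc)
  also have "\<dots> = (\<Sum>k\<in>UNIV. b_fun f h k * cnj (e k r))"
    by (simp add: b_fun_commute)
  also have "\<dots> = (\<Sum>k\<in>UNIV. \<Sum>s\<in>UNIV. complex_of_real (weight f (h, s)) * e (s - r) k)"
    using e_add_right [of k s "- r" for k s]
    by (simp add: b_fun_eq_weight_sum sum_distrib_right mult.assoc e_minus_right e_sym [of "_ - _"])
  also have "\<dots> = (\<Sum>s\<in>UNIV. complex_of_real (weight f (h, s)) * (\<Sum>k\<in>UNIV. e (s - r) k))"
    by (subst sum.swap) (simp add: sum_distrib_left)
  also have "\<dots> = complex_of_real (weight f (h, r)) * of_nat CARD('g)"
    by (simp add: e_sum if_distrib cong: if_cong)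
  finally show ?thesis
    by (simp add: v)
qed

lemma weight_minus: "weight f (- v) = weight f v"
proof -
  have "complex_of_real (weight f (- v)) = cnj (complex_of_real (weight f v))"
    unfolding weight_self_dual [of f "- v"] weight_self_dual [of f v]
    by (simp add: pairing_minus_left)
  then show ?thesis
    by simp
qed

lemma weight_sum: "(\<Sum>v\<in>UNIV. weight f v) = weight f 0 * CARD('g)"
proof -
  have "complex_of_real (weight f 0) = complex_of_real ((\<Sum>v\<in>UNIV. weight f v) / CARD('g))"
    using weight_self_dual [of f 0] by (simp add: pairing_def e_zero_left e_sym [of _ 0])
  then have "weight f 0 = (\<Sum>v\<in>UNIV. weight f v) / CARD('g)"
    by (simp only: of_real_eq_iff)
  then show ?thesis
    by simp
qed

lemma weight_le_zero: "weight f v \<le> weight f 0"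
proof -
  have "weight f v = norm (complex_of_real (weight f v))"
    using weight_nonneg by simp
  also have "\<dots> \<le> (\<Sum>w\<in>UNIV. norm (complex_of_real (weight f w) * pairing v w)) / CARD('g)"
    unfolding weight_self_dual [of f v]
    by (simp add: norm_divide divide_right_mono norm_sum)
  also have "\<dots> = weight f 0"
    by (simp add: norm_mult norm_pairing weight_nonneg weight_sum)
  finally show ?thesis .
qed

text \<open>By self-duality the linear form is the weighted mean of the transform G of g, and the
  quadratic form is that of |G|^2. Cauchy-Schwarz compares them with the constant
  \<open>weight f 0\<close>, which is at most 1 for one-bounded f.\<close>

lemma weight_pos_def:
  assumes "one_bounded f"
  shows "(\<Sum>v\<in>UNIV. g v * weight f v)\<^sup>2
      \<le> (\<Sum>c\<in>UNIV. \<Sum>d\<in>UNIV. g c * g d * weight f (c - d))"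
proof -
  let ?N = "real CARD('g)" and ?w = "weight f"
  define G where "G u = (\<Sum>c\<in>UNIV. complex_of_real (g c) * pairing c u)" for u
  have lin: "complex_of_real (\<Sum>v\<in>UNIV. g v * ?w v) = (\<Sum>u\<in>UNIV. complex_of_real (?w u) * G u) / ?N"
  proof -
    have "complex_of_real (\<Sum>v\<in>UNIV. g v * ?w v)
        = (\<Sum>v\<in>UNIV. \<Sum>u\<in>UNIV. complex_of_real (g v) * (complex_of_real (?w u) * pairing v u) / ?N)"
      by (simp, subst weight_self_dual) (simp add: sum_distrib_left sum_divide_distrib)
    also have "\<dots> = (\<Sum>u\<in>UNIV. complex_of_real (?w u) * G u) / ?N"
      by (subst sum.swap) (simp add: G_def sum_distrib_left sum_divide_distrib ac_simps)
    finally show ?thesis .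
  qed
  have quad: "complex_of_real (\<Sum>c\<in>UNIV. \<Sum>d\<in>UNIV. g c * g d * ?w (c - d))
      = complex_of_real ((\<Sum>u\<in>UNIV. ?w u * (norm (G u))\<^sup>2) / ?N)"
  proof -
    have G_sq: "complex_of_real ((norm (G u))\<^sup>2) =
        (\<Sum>c\<in>UNIV. \<Sum>d\<in>UNIV. complex_of_real (g c * g d) * pairing (c - d) u)" for u
    proof -
      have "complex_of_real ((norm (G u))\<^sup>2) = G u * cnj (G u)"
        by (rule complex_norm_square)
      then show ?thesis
        using pairing_add_left [of c "- d" u for c d]
        by (simp add: G_def sum_product pairing_minus_left ac_simps)
    qed
    have "complex_of_real (\<Sum>c\<in>UNIV. \<Sum>d\<in>UNIV. g c * g d * ?w (c - d))
        = (\<Sum>c\<in>UNIV. \<Sum>d\<in>UNIV. \<Sum>u\<in>UNIV. complex_of_real (?w u)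
            * (complex_of_real (g c * g d) * pairing (c - d) u)) / ?N"
      by (simp, subst weight_self_dual) (simp add: sum_distrib_left sum_divide_distrib ac_simps)
    also have "\<dots> = (\<Sum>c\<in>UNIV. \<Sum>u\<in>UNIV. \<Sum>d\<in>UNIV. complex_of_real (?w u)
            * (complex_of_real (g c * g d) * pairing (c - d) u)) / ?N"
      by (subst (2) sum.swap) (rule refl)
    also have "\<dots> = (\<Sum>u\<in>UNIV. \<Sum>c\<in>UNIV. \<Sum>d\<in>UNIV. complex_of_real (?w u)
            * (complex_of_real (g c * g d) * pairing (c - d) u)) / ?N"
      by (subst sum.swap) (rule refl)
    also have "\<dots> = (\<Sum>u\<in>UNIV. complex_of_real (?w u) * complex_of_real ((norm (G u))\<^sup>2)) / ?N"
      unfolding G_sq by (simp add: sum_distrib_left)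
    finally show ?thesis
      by simp
  qed
  have "\<bar>\<Sum>v\<in>UNIV. g v * ?w v\<bar> = norm (complex_of_real (\<Sum>v\<in>UNIV. g v * ?w v))"
    by (simp only: norm_of_real)
  also have "\<dots> \<le> (\<Sum>u\<in>UNIV. ?w u * norm (G u)) / ?N"
  proof -
    have "norm (\<Sum>u\<in>UNIV. complex_of_real (?w u) * G u) \<le> (\<Sum>u\<in>UNIV. ?w u * norm (G u))"
      by (rule order_trans [OF norm_sum]) (simp add: norm_mult weight_nonneg)
    then show ?thesis
      unfolding lin by (simp add: norm_divide divide_right_mono)
  qed
  finally have "(\<Sum>v\<in>UNIV. g v * ?w v)\<^sup>2 \<le> ((\<Sum>u\<in>UNIV. ?w u * norm (G u)) / ?N)\<^sup>2"
    by (metis abs_ge_zero power2_abs power_mono)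
  also have "\<dots> = (\<Sum>u\<in>UNIV. sqrt (?w u) * (sqrt (?w u) * norm (G u)))\<^sup>2 / ?N\<^sup>2"
    by (simp add: power_divide weight_nonneg flip: mult.assoc)
  also have "\<dots> \<le> (\<Sum>u\<in>UNIV. (sqrt (?w u))\<^sup>2) * (\<Sum>u\<in>UNIV. (sqrt (?w u) * norm (G u))\<^sup>2) / ?N\<^sup>2"
    by (intro divide_right_mono Cauchy_Schwarz_ineq_sum) simp
  also have "\<dots> = weight f 0 * ((\<Sum>u\<in>UNIV. ?w u * (norm (G u))\<^sup>2) / ?N)"
    by (simp add: power_mult_distrib weight_nonneg weight_sum power2_eq_square [of "real CARD('g)"])
  also have "\<dots> \<le> 1 * ((\<Sum>u\<in>UNIV. ?w u * (norm (G u))\<^sup>2) / ?N)"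
    by (intro mult_right_mono weight_le_one assms divide_nonneg_nonneg sum_nonneg) (simp_all add: weight_nonneg)
  also have "\<dots> = (\<Sum>c\<in>UNIV. \<Sum>d\<in>UNIV. g c * g d * ?w (c - d))"
    using quad by (simp only: of_real_eq_iff mult_1)
  finally show ?thesis .
qed

lemma self_dual_weight_weight:
  assumes "one_bounded f"
  shows "self_dual_weight (weight f) (real CARD('g))"
proof
  show "(\<Sum>v\<in>UNIV. weight f v) \<le> real CARD('g)"
    using weight_le_one [OF assms, of 0] by (simp add: weight_sum)
qed (simp_all add: weight_nonneg weight_le_one weight_minus weight_pos_def assms)

section \<open>Dilated correlations of the weight and averages of b\<close>

text \<open>By self-duality the left-hand side equals the right-hand side with phases inserted.\<close>

lemma weight_dilate_shift_le:
  "(\<Sum>v\<in>UNIV. weight f v * weight f (nat_mult n v + c)) \<le> (\<Sum>v\<in>UNIV. weight f v * weight f (nat_mult n v))"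
proof -
  let ?w = "weight f" and ?N = "complex_of_nat CARD('g)"
  have flip: "(\<Sum>v\<in>UNIV. complex_of_real (?w v) * pairing v u) / ?N = complex_of_real (?w u)" for u
  proof -
    have "complex_of_real (?w u) = cnj (complex_of_real (?w u))"
      by simp
    also have "\<dots> = (\<Sum>v\<in>UNIV. complex_of_real (?w v) * pairing v u) / ?N"
      unfolding weight_self_dual [of f u] by (simp add: cnj_pairing)
    finally show ?thesis ..
  qed
  \<comment> \<open>Only the dilated factor is expanded. The pairing moves the dilation from v to u,
    after which \<open>flip\<close> evaluates the sum over v; the shift c survives as a
    phase.\<close>
  have "complex_of_real (\<Sum>v\<in>UNIV. ?w v * ?w (nat_mult n v + c))
      = (\<Sum>v\<in>UNIV. \<Sum>u\<in>UNIV. complex_of_real (?w u) * pairing c u *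
          (complex_of_real (?w v) * pairing v (nat_mult n u) / ?N))"
    by (simp, subst (2) weight_self_dual)
      (simp add: pairing_add_left pairing_nat_mult sum_distrib_left sum_divide_distrib ac_simps)
  also have "\<dots> = (\<Sum>u\<in>UNIV. complex_of_real (?w u) * pairing c u * complex_of_real (?w (nat_mult n u)))"
    by (subst sum.swap) (simp only: sum_distrib_left [symmetric] sum_divide_distrib [symmetric] flip)
  finally have eq: "complex_of_real (\<Sum>v\<in>UNIV. ?w v * ?w (nat_mult n v + c)) = \<dots>" .
  have "(\<Sum>v\<in>UNIV. ?w v * ?w (nat_mult n v + c))
      = norm (complex_of_real (\<Sum>v\<in>UNIV. ?w v * ?w (nat_mult n v + c)))"
    by (simp only: norm_of_real) (simp add: sum_nonneg weight_nonneg)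
  also have "\<dots> \<le> (\<Sum>u\<in>UNIV. norm (complex_of_real (?w u) * pairing c u * complex_of_real (?w (nat_mult n u))))"
    unfolding eq by (rule norm_sum)
  also have "\<dots> = (\<Sum>u\<in>UNIV. ?w u * ?w (nat_mult n u))"
    by (simp add: norm_mult norm_pairing weight_nonneg)
  finally show ?thesis .
qed

text \<open>Expanding both factors by \<open>b_fun_eq_weight_sum\<close>, the average over h' forces
  r = s q because s is self-adjoint for e. The identity map yields the U^3 norm, scaling by a the
  average of the theorem.\<close>

lemma avg_b_fun_dilates:
  assumes s: "\<And>x r. e (s x) r = e x (s r)"
  shows "avg (\<lambda>(h, h'). b_fun f (s h) h' * cnj (b_fun f h (s h'))) =
    complex_of_real ((\<Sum>(h, r)\<in>UNIV. weight f (h, r) * weight f (s h, s r)) / CARD('g))"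
proof -
  let ?w = "\<lambda>h r. complex_of_real (weight f (h, r))" and ?N = "complex_of_nat CARD('g)"
  have inner: "avg (\<lambda>h'. b_fun f (s h) h' * cnj (b_fun f h (s h'))) = (\<Sum>q\<in>UNIV. ?w h q * ?w (s h) (s q))" for h
  proof -
    have "b_fun f (s h) h' * cnj (b_fun f h (s h'))
        = (\<Sum>r\<in>UNIV. \<Sum>q\<in>UNIV. ?w (s h) r * ?w h q * e (r - s q) h')" for h'
    proof -
      have "e h' r * cnj (e (s h') q) = e (r - s q) h'" for r q
        using e_add_right [of h' r "- s q"] by (simp add: s e_minus_right e_sym [of "_ - _"])
      then show ?thesis
        by (simp add: b_fun_eq_weight_sum sum_product mult.assoc mult.left_commute [of "e h' _"])
    qed
    then have "(\<Sum>h'\<in>UNIV. b_fun f (s h) h' * cnj (b_fun f h (s h')))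
        = (\<Sum>h'\<in>UNIV. \<Sum>r\<in>UNIV. \<Sum>q\<in>UNIV. ?w (s h) r * ?w h q * e (r - s q) h')"
      by simp
    also have "\<dots> = (\<Sum>r\<in>UNIV. \<Sum>h'\<in>UNIV. \<Sum>q\<in>UNIV. ?w (s h) r * ?w h q * e (r - s q) h')"
      by (subst sum.swap) (rule refl)
    also have "\<dots> = (\<Sum>r\<in>UNIV. \<Sum>q\<in>UNIV. \<Sum>h'\<in>UNIV. ?w (s h) r * ?w h q * e (r - s q) h')"
      by (subst (2) sum.swap) (rule refl)
    also have "\<dots> = (\<Sum>r\<in>UNIV. \<Sum>q\<in>UNIV. ?w (s h) r * ?w h q * (\<Sum>h'\<in>UNIV. e (r - s q) h'))"
      by (simp add: sum_distrib_left)
    also have "\<dots> = (\<Sum>q\<in>UNIV. \<Sum>r\<in>UNIV. if r = s q then ?w (s h) r * ?w h q * ?N else 0)"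
      by (subst sum.swap) (simp add: e_sum if_distrib cong: if_cong)
    also have "\<dots> = (\<Sum>q\<in>UNIV. ?w h q * ?w (s h) (s q)) * ?N"
      by (simp add: sum_distrib_right mult.commute [of "?w (s h) _"])
    finally show ?thesis
      by (simp add: avg_def)
  qed
  have "avg (\<lambda>(h, h'). b_fun f (s h) h' * cnj (b_fun f h (s h')))
      = (\<Sum>h\<in>UNIV. \<Sum>q\<in>UNIV. ?w h q * ?w (s h) (s q)) / ?N"
    unfolding avg_pair inner by (simp add: avg_def)
  also have "(\<Sum>h\<in>UNIV. \<Sum>q\<in>UNIV. ?w h q * ?w (s h) (s q))
      = (\<Sum>(h, r)\<in>UNIV. ?w h r * ?w (s h) (s r))"
    unfolding UNIV_Times_UNIV [symmetric] sum.cartesian_product by (rule refl)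
  finally show ?thesis
    by (simp add: split_def)
qed

lemma dilate_correlation_ge:
  assumes f: "one_bounded f"
    and n: "2 ^ k \<le> n" "n < 2 ^ Suc k" "k \<le> 2 ^ j"
  shows "((\<Sum>v\<in>UNIV. (weight f v)\<^sup>2) / CARD('g)) ^ (32 * 2 ^ j)
      \<le> (\<Sum>v\<in>UNIV. weight f v * weight f (nat_mult n v)) / CARD('g)"
proof -
  interpret self_dual_weight "weight f" "real CARD('g)"
    by (rule self_dual_weight_weight [OF f])
  have "wsum (\<lambda>v. weight f (nat_mult n v + c)) \<le> (\<Sum>v\<in>UNIV. weight f v * weight f (nat_mult n v)) / CARD('g)" for c
    unfolding wsum_def nsum_def by (intro divide_right_mono weight_dilate_shift_le) simp
  from energy_power_le [OF this n] show ?thesis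
    by (simp add: energy_def nsum_def)
qed

lemma U3_norm_eq_weight: "gowers_U3_norm f ^ 8 = (\<Sum>v\<in>UNIV. (weight f v)\<^sup>2) / CARD('g)"
proof -
  have "complex_of_real (gowers_U3_norm f ^ 8) = avg (\<lambda>(h, h'). b_fun f h h' * cnj (b_fun f h h'))"
    unfolding gowers_U3_norm_power8 of_real_avg
    by (simp add: split_def complex_norm_square del: of_real_power)
  also have "\<dots> = complex_of_real ((\<Sum>v\<in>UNIV. (weight f v)\<^sup>2) / CARD('g))"
    using avg_b_fun_dilates [of "\<lambda>x. x" f] by (simp add: split_def power2_eq_square)
  finally show ?thesis
    by (simp only: of_real_eq_iff)
qed

end

section \<open>Additive characters of vector spaces over a prime field\<close>

definition mod_char :: "'p::prime_card mod_ring \<Rightarrow> complex" where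
  "mod_char x = cis (2 * pi * (of_int (to_int_mod_ring x) / CARD('p)))"

lemma mod_char_add: "mod_char (x + y) = mod_char x * mod_char y"
  for x y :: "'p::prime_card mod_ring"
proof -
  let ?p = "real CARD('p)"
  define k where "k = to_int_mod_ring x + to_int_mod_ring y"
  \<comment> \<open>Reducing the sum of the representatives modulo p changes the angle by whole
    turns only.\<close>
  have "real_of_int k = real_of_int (k mod int CARD('p)) + ?p * real_of_int (k div int CARD('p))"
    by (metis add.commute mult_div_mod_eq of_int_add of_int_mult of_int_of_nat_eq)
  then have "2 * pi * (real_of_int k / ?p)
      = 2 * pi * (real_of_int (k mod int CARD('p)) / ?p) + 2 * pi * real_of_int (k div int CARD('p))"
    by (simp add: field_simps)
  then have "cis (2 * pi * (real_of_int k / ?p)) = cis (2 * pi * (real_of_int (k mod int CARD('p)) / ?p))"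
    by (simp add: cis_mult [symmetric] cis_multiple_2pi)
  then show ?thesis
    by (simp add: mod_char_def to_int_mod_ring_add k_def cis_mult add_divide_distrib ring_distribs)
qed

lemma mod_char_one: "mod_char (1 :: 'p::prime_card mod_ring) \<noteq> 1"
proof -
  have p: "CARD('p) \<ge> 2"
    using prime_card [where ?'a = 'p] by (rule prime_ge_2_nat)
  then have "cos (2 * pi / CARD('p)) < cos 0"
    by (intro cos_monotone_0_pi) (auto simp: field_simps)
  then show ?thesis
    by (auto simp: mod_char_def complex_eq_iff)
qed

definition vec_char :: "('p::prime_card mod_ring) ^ 'n \<Rightarrow> 'p mod_ring ^ 'n \<Rightarrow> complex" where
  "vec_char x r = mod_char (\<Sum>i\<in>UNIV. x $ i * r $ i)"

lemma vec_char_add_left: "vec_char (x + y) r = vec_char x r * vec_char y r"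
  by (simp add: vec_char_def ring_distribs sum.distrib mod_char_add)

lemma vec_char_sym: "vec_char x r = vec_char r x"
  by (simp add: vec_char_def mult.commute)

lemma vec_char_smult: "vec_char (c *s x) r = vec_char x (c *s r)"
  by (simp add: vec_char_def mult.left_commute mult.assoc)

lemma sum_vec_char:
  "(\<Sum>r\<in>UNIV. vec_char x r) = (if x = 0 then of_nat CARD('p mod_ring ^ 'n) else 0)"
  for x :: "('p::prime_card mod_ring) ^ 'n"
proof (cases "x = 0")
  case True
  then show ?thesis
    by (simp add: vec_char_def mod_char_def)
next
  case False
  then obtain i where i: "x $ i \<noteq> 0"
    by (auto simp: vec_eq_iff)
  \<comment> \<open>A vector whose dot product with x is 1: translating the sum by it multiplies the
    sum by a number other than 1.\<close>
  let ?s = "axis i (inverse (x $ i))"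
  have "(\<Sum>j\<in>UNIV. x $ j * ?s $ j) = (\<Sum>j\<in>UNIV. if j = i then 1 else 0)"
    using i by (intro sum.cong) (auto simp: axis_def)
  then have s: "vec_char x ?s \<noteq> 1"
    by (simp add: vec_char_def mod_char_one)
  have "(\<Sum>r\<in>UNIV. vec_char x r) = (\<Sum>r\<in>UNIV. vec_char x (r + ?s))"
    by (rule sum.reindex_bij_witness [of _ "\<lambda>r. r + ?s" "\<lambda>r. r - ?s"]) auto
  also have "\<dots> = (\<Sum>r\<in>UNIV. vec_char x r) * vec_char x ?s"
    by (simp add: sum_distrib_right vec_char_sym [of x] vec_char_add_left)
  finally show ?thesis
    using s False by simp
qed

interpretation vec_char: self_dual_group vec_char
proof
  show "norm (vec_char x r) = 1" for x r :: "'p::prime_card mod_ring ^ 'n"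
    by (simp add: vec_char_def mod_char_def)
qed (fact vec_char_add_left vec_char_sym sum_vec_char)+

section \<open>The exponent and the conclusion\<close>

text \<open>Here k counts the binary digits of |a| after the leading one, and j is the least
  exponent with \<open>k \<le> 2 ^ j\<close>. For k at least 2 this is one more than the integer
  part of the logarithm of k - 1, which explains the shift by 1 inside the nested logarithm.\<close>

lemma exponent_M_digits:
  assumes "a \<noteq> 0"
  obtains k j where "2 ^ k \<le> nat \<bar>a\<bar>" "nat \<bar>a\<bar> < 2 ^ Suc k" "k \<le> 2 ^ j" "exponent_M a = 5 + j"
proof -
  let ?n = "nat \<bar>a\<bar>"
  have log_eq: "\<lfloor>log 2 (real m)\<rfloor> = int i" if "2 ^ i \<le> m" "m < 2 ^ Suc i" for m i :: nat
    using floor_log_nat_eq_powr_iff [of 2 m i] that by auto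
  have "?n \<ge> 1"
    using assms by linarith
  then obtain k where k: "2 ^ k \<le> ?n" "?n < 2 ^ Suc k"
    using ex_power_ivl1 [of 2 ?n] by auto
  show ?thesis
  proof (cases "\<bar>a\<bar> \<ge> 4")
    case False
    then have "?n < 2 ^ 2"
      by simp
    with k(1) have "(2::nat) ^ k < 2 ^ 2"
      by linarith
    then have "k < 2"
      by (rule power_less_imp_less_exp [rotated]) simp
    then show ?thesis
      using False k by (intro that [of k 0]) (auto simp: exponent_M_def)
  next
    case True
    then have "(2::nat) ^ 2 \<le> ?n"
      by simp
    with k(2) have "(2::nat) ^ 2 < 2 ^ Suc k"
      by linarith
    then have "2 < Suc k"
      by (rule power_less_imp_less_exp [rotated]) simp
    then have "1 \<le> k - 1"
      by simp
    then obtain q where q: "2 ^ q \<le> k - 1" "k - 1 < 2 ^ Suc q"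
      using ex_power_ivl1 [of 2 "k - 1"] by auto
    have "\<lfloor>log 2 (real_of_int \<bar>a\<bar>) - 1\<rfloor> = int (k - 1)"
      using log_eq [OF k] \<open>2 < Suc k\<close> by simp
    then have "\<lfloor>log 2 (real_of_int \<lfloor>log 2 (real_of_int \<bar>a\<bar>) - 1\<rfloor>)\<rfloor> = int q"
      using log_eq [OF q] by simp
    then have "exponent_M a = 5 + Suc q"
      using True by (simp add: exponent_M_def)
    then show ?thesis
      using k q by (intro that [of k "Suc q"]) auto
  qed
qed

lemma of_nat_smult_eq_nat_mult: "of_nat n *s x = nat_mult n x"
  for x :: "'a::ring_1 ^ 'n"
  by (induction n) (simp_all add: vec_eq_iff ring_distribs)

theorem theorem1p10:
  fixes f :: "('p::prime_card mod_ring) ^ 'n \<Rightarrow> complex"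
    and \<delta> :: real and a :: int
  assumes "CARD('p) > 2"
    and "one_bounded f"
    and "\<delta> \<ge> 0"
    and "gowers_U3_norm f ^ 8 \<ge> \<delta>"
  shows "let S = avg (\<lambda>(h, h'). b_fun f (of_int a *s h) h' * cnj (b_fun f h (of_int a *s h')))
         in S \<in> \<real> \<and> Re S \<ge> \<delta> ^ (2 ^ exponent_M a)"
proof -
  let ?w = "vec_char.weight f" and ?N = "real CARD('p mod_ring ^ 'n)"
  let ?U = "(\<Sum>v\<in>UNIV. (?w v)\<^sup>2) / ?N"
    and ?T = "(\<Sum>v\<in>UNIV. ?w v * ?w (nat_mult (nat \<bar>a\<bar>) v)) / ?N"
  have smult: "of_int a *s x = (if a \<ge> 0 then nat_mult (nat \<bar>a\<bar>) x else - nat_mult (nat \<bar>a\<bar>) x)"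
    for x :: "'p mod_ring ^ 'n"
    by (simp flip: of_nat_smult_eq_nat_mult)
  \<comment> \<open>The weight is even, so the sign of a disappears.\<close>
  have "?w (of_int a *s h, of_int a *s r) = ?w (nat_mult (nat \<bar>a\<bar>) (h, r))" for h r
    unfolding smult
    using vec_char.weight_minus [of f "nat_mult (nat \<bar>a\<bar>) (h, r)"]
    by (auto simp: nat_mult_Pair simp del: abs_of_nonneg abs_of_neg)
  then have S: "avg (\<lambda>(h, h'). b_fun f (of_int a *s h) h' * cnj (b_fun f h (of_int a *s h')))
      = complex_of_real ?T"
    using vec_char.avg_b_fun_dilates [of "(*s) (of_int a)" f, OF vec_char_smult]
    by (simp add: split_def)
  have \<delta>: "\<delta> \<le> ?U"
    using assms(4) by (simp add: vec_char.U3_norm_eq_weight)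
  have "\<delta> ^ (2 ^ exponent_M a) \<le> ?U ^ (2 ^ exponent_M a)"
    by (rule power_mono [OF \<delta> assms(3)])
  also have "\<dots> \<le> ?T"
  proof (cases "a = 0")
    case False
    then obtain k j where kj: "2 ^ k \<le> nat \<bar>a\<bar>" "nat \<bar>a\<bar> < 2 ^ Suc k" "k \<le> 2 ^ j" "exponent_M a = 5 + j"
      by (rule exponent_M_digits)
    then show ?thesis
      using vec_char.dilate_correlation_ge [OF assms(2) kj(1-3)] by (simp add: power_add)
  next
    \<comment> \<open>Zero has no leading digit. Instead, the energy lies between 0 and 1, so its
      power is at most itself, and the weight is largest at 0.\<close>
    case True
    interpret self_dual_weight ?w ?N
      by (rule vec_char.self_dual_weight_weight [OF assms(2)])
    have "0 \<le> ?U" "?U \<le> 1"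
      using energy_nonneg energy_le_one by (simp_all only: energy_def nsum_def)
    then have "?U ^ (2 ^ exponent_M a) \<le> ?U ^ 1"
      by (intro power_decreasing one_le_power) (rule one_le_numeral, assumption+)
    also have "\<dots> \<le> ?T"
      unfolding True by (auto simp: power2_eq_square vec_char.weight_le_zero nonneg
          intro!: divide_right_mono sum_mono mult_left_mono)
    finally show ?thesis .
  qed
  finally show ?thesis
    unfolding S by (simp add: Let_def)
qed

end
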